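(* If $U$ is a star topology (a tree with a center node adjacent to all other nodes), then every vertex of the polyhedron of the STT LP for $U$ is integer.
   Context: For a tree $U$ and distinct nodes $i,j$, $(i\leftrightsquigarrow j)$ denotes the nodes strictly between $i$ and $j$ on the $U$-path. The STT LP for $U$ has variables $D_i$ ($i\in U$), $X_{ij}$ ($i\ne j$), $Z_{kij}=Z_{kji}$ ($k\in(i\leftrightsquigarrow j)$); constraints $X_{ij}\ge0$, $Z_{kij}\ge0$; for all $i\ne j$: $X_{ij}+X_{ji}+\sum_{k\in(i\leftrightsquigarrow j)}Z_{kij}\ge1$; $Z_{kij}\le X_{ki}$, $Z_{kij}\le X_{kj}$; $D_i\ge\sum_{j\ne i}X_{ji}$. *)

theory Defs
  imports "HOL-Analysis.Analysis"
begin

text \<open>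
  A graph on the finite node type \<open>'n\<close> is given by its adjacency relation \<open>U\<close>.
\<close>

definition path_between :: "('n \<Rightarrow> 'n \<Rightarrow> bool) \<Rightarrow> 'n \<Rightarrow> 'n list \<Rightarrow> 'n \<Rightarrow> bool" where
  "path_between U i p j \<longleftrightarrow>
     p \<noteq> [] \<and> hd p = i \<and> last p = j \<and> distinct p \<and> successively U p"

definition graph_cycle :: "('n \<Rightarrow> 'n \<Rightarrow> bool) \<Rightarrow> 'n list \<Rightarrow> bool" where
  "graph_cycle U p \<longleftrightarrow>
     length p \<ge> 3 \<and> distinct p \<and> successively U p \<and> U (last p) (hd p)"

definition is_tree :: "('n \<Rightarrow> 'n \<Rightarrow> bool) \<Rightarrow> bool" where
  "is_tree U \<longleftrightarrow>
     symp U \<and> irreflp U \<and> (\<forall>i j. \<exists>p. path_between U i p j) \<and> (\<nexists>p. graph_cycle U p)"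

definition star_topology :: "('n \<Rightarrow> 'n \<Rightarrow> bool) \<Rightarrow> bool" where
  "star_topology U \<longleftrightarrow> is_tree U \<and> (\<exists>c. \<forall>i. i \<noteq> c \<longrightarrow> U c i)"

text \<open>
  In a tree the path from \<open>i\<close> to \<open>j\<close> is unique, so \<open>strictly_between U i j\<close> is the set of
  nodes on it other than its two ends.
\<close>

definition strictly_between :: "('n \<Rightarrow> 'n \<Rightarrow> bool) \<Rightarrow> 'n \<Rightarrow> 'n \<Rightarrow> 'n set" where
  "strictly_between U i j = {k. k \<noteq> i \<and> k \<noteq> j \<and> (\<exists>p. path_between U i p j \<and> k \<in> set p)}"

text \<open>
  A point \<open>(D, X, Z)\<close> has the entries \<open>D $ i\<close>, \<open>X $ i $ j\<close> and \<open>Z $ k $ i $ j\<close>.  The program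
  has no variable \<open>X\<^sub>i\<^sub>i\<close> and no variable \<open>Z\<^sub>k\<^sub>i\<^sub>j\<close> for \<open>k\<close> not strictly between \<open>i\<close> and \<open>j\<close>;
  these entries are set to zero, and \<open>Z\<^sub>k\<^sub>i\<^sub>j\<close> and \<open>Z\<^sub>k\<^sub>j\<^sub>i\<close> are identified by an equation.
  This embeds the space of the variables of the program as a linear subspace, so the vertices are
  those of the program.
\<close>

type_synonym 'n stt_point = "(real ^ 'n) \<times> (real ^ 'n ^ 'n) \<times> (real ^ 'n ^ 'n ^ 'n)"

definition stt_polyhedron :: "('n::finite \<Rightarrow> 'n \<Rightarrow> bool) \<Rightarrow> 'n stt_point set" where
  "stt_polyhedron U = {(D, X, Z).
     (\<forall>i. X $ i $ i = 0) \<and>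
     (\<forall>i j k. k \<notin> strictly_between U i j \<longrightarrow> Z $ k $ i $ j = 0) \<and>
     (\<forall>i j k. Z $ k $ i $ j = Z $ k $ j $ i) \<and>
     (\<forall>i j. i \<noteq> j \<longrightarrow> X $ i $ j \<ge> 0) \<and>
     (\<forall>i j. i \<noteq> j \<longrightarrow> (\<forall>k \<in> strictly_between U i j. Z $ k $ i $ j \<ge> 0)) \<and>
     (\<forall>i j. i \<noteq> j \<longrightarrow>
        X $ i $ j + X $ j $ i + (\<Sum>k \<in> strictly_between U i j. Z $ k $ i $ j) \<ge> 1) \<and>
     (\<forall>i j. i \<noteq> j \<longrightarrow> (\<forall>k \<in> strictly_between U i j.
        Z $ k $ i $ j \<le> X $ k $ i \<and> Z $ k $ i $ j \<le> X $ k $ j)) \<and>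
     (\<forall>i. D $ i \<ge> (\<Sum>j \<in> UNIV - {i}. X $ j $ i))}"

definition integer_point :: "'n::finite stt_point \<Rightarrow> bool" where
  "integer_point = (\<lambda>(D, X, Z).
     (\<forall>i. D $ i \<in> \<int>) \<and> (\<forall>i j. X $ i $ j \<in> \<int>) \<and> (\<forall>k i j. Z $ k $ i $ j \<in> \<int>))"

end

theory Submission
  imports Defs
begin

text \<open>
  At a vertex no nonzero direction is compatible with all tight constraints.  Raising \<open>D\<^sub>i\<close> alone shows that
  \<open>D\<^sub>i\<close> equals its lower bound, and trading \<open>X\<^sub>i\<^sub>j\<close> against \<open>X\<^sub>j\<^sub>i\<close> for two leaves \<open>i\<close>, \<open>j\<close> shows that
  one of the two vanishes.  In a star with centre \<open>c\<close>, every tight constraint among the remaining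
  ones then either makes a variable zero, equates some \<open>Z\<^sub>c\<^sub>i\<^sub>j\<close> with some \<open>X\<^sub>c\<^sub>i\<close>, or makes a variable of
  this kind and some \<open>X\<^sub>i\<^sub>j\<close> with \<open>i \<noteq> c\<close> sum to one.  So increasing all fractional \<open>X\<^sub>c\<^sub>i\<close> and \<open>Z\<^sub>c\<^sub>i\<^sub>j\<close>
  while decreasing all other fractional \<open>X\<^sub>i\<^sub>j\<close> at the same rate keeps every tight constraint tight;
  hence there are no fractional entries.
\<close>

text \<open>An inequality of the program constrains the direction only where the point attains it,
  and then as an equation, not an inequality. The notion is thus closed under negation.\<close>

definition tight_direction ::
  "('n::finite \<Rightarrow> 'n \<Rightarrow> bool) \<Rightarrow> 'n stt_point \<Rightarrow> 'n stt_point \<Rightarrow> bool" where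
  "tight_direction U = (\<lambda>(D, X, Z) (D', X', Z').
     (\<forall>i. X' $ i $ i = 0) \<and>
     (\<forall>i j k. k \<notin> strictly_between U i j \<longrightarrow> Z' $ k $ i $ j = 0) \<and>
     (\<forall>i j k. Z' $ k $ i $ j = Z' $ k $ j $ i) \<and>
     (\<forall>i j. i \<noteq> j \<longrightarrow> X $ i $ j = 0 \<longrightarrow> X' $ i $ j = 0) \<and>
     (\<forall>i j. i \<noteq> j \<longrightarrow> (\<forall>k \<in> strictly_between U i j. Z $ k $ i $ j = 0 \<longrightarrow> Z' $ k $ i $ j = 0)) \<and>
     (\<forall>i j. i \<noteq> j \<longrightarrow>
        X $ i $ j + X $ j $ i + (\<Sum>k \<in> strictly_between U i j. Z $ k $ i $ j) = 1 \<longrightarrow>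
        X' $ i $ j + X' $ j $ i + (\<Sum>k \<in> strictly_between U i j. Z' $ k $ i $ j) = 0) \<and>
     (\<forall>i j. i \<noteq> j \<longrightarrow> (\<forall>k \<in> strictly_between U i j.
        (Z $ k $ i $ j = X $ k $ i \<longrightarrow> Z' $ k $ i $ j = X' $ k $ i) \<and>
        (Z $ k $ i $ j = X $ k $ j \<longrightarrow> Z' $ k $ i $ j = X' $ k $ j))) \<and>
     (\<forall>i. D $ i = (\<Sum>j \<in> UNIV - {i}. X $ j $ i) \<longrightarrow> D' $ i = (\<Sum>j \<in> UNIV - {i}. X' $ j $ i)))"

text \<open>A strict inequality survives small \<open>e\<close> by continuity; an equality persists
  because both sides move at the same rate. The guard \<open>P\<close> holds the index conditions,
  so that finite quantifiers can be pulled out of the filter.\<close>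

lemma eventually_le_add_scaled:
  fixes a b a' b' :: real
  assumes "P \<Longrightarrow> a \<le> b" and "P \<Longrightarrow> a = b \<Longrightarrow> a' = b'"
  shows "\<forall>\<^sub>F e in at_right 0. P \<longrightarrow> a + e * a' \<le> b + e * b'"
proof (cases "P \<and> a \<noteq> b")
  case False
  then show ?thesis using assms(2) by auto
next
  case True
  then have "0 < b - a" using assms(1) by simp
  moreover have "((\<lambda>e. (b + e * b') - (a + e * a')) \<longlongrightarrow> b - a) (at_right 0)"
    by (auto intro!: tendsto_eq_intros)
  ultimately have "\<forall>\<^sub>F e in at_right 0. 0 < (b + e * b') - (a + e * a')"
    by (rule order_tendstoD(1)[rotated])
  then show ?thesis by (rule eventually_mono) simp
qed

lemma tight_direction_minus:
  "tight_direction U v w \<Longrightarrow> tight_direction U v (- w)"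
proof -
  \<comment> \<open>The left side is the form that simplification gives to the negated cover
    equation.\<close>
  have "- x - y = s \<longleftrightarrow> x + y + s = 0" for x y s :: real by linarith
  then show "tight_direction U v w \<Longrightarrow> tight_direction U v (- w)"
    by (cases v; cases w) (simp add: tight_direction_def sum_negf)
qed

lemma eventually_add_tight_direction:
  assumes v: "v \<in> stt_polyhedron U" and w: "tight_direction U v w"
  shows "\<forall>\<^sub>F e in at_right 0. v + e *\<^sub>R w \<in> stt_polyhedron U"
proof -
  obtain D X Z where [simp]: "v = (D, X, Z)" by (cases v)
  obtain D' X' Z' where [simp]: "w = (D', X', Z')" by (cases w)
  let ?S = "strictly_between U"
  note v' = v[unfolded stt_polyhedron_def, simplified]
  note w' = w[unfolded tight_direction_def, simplified]
  \<comment> \<open>Each family of constraints is put into the shape of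
    \<open>eventually_le_add_scaled\<close>; hence the terms \<open>e * 0\<close> and, for the last
    family, the guard \<open>True\<close>.\<close>
  have 1: "\<forall>\<^sub>F e in at_right 0. \<forall>i j. i \<noteq> j \<longrightarrow> 0 + e * 0 \<le> X $ i $ j + e * X' $ i $ j"
    using v' w' by (intro eventually_all_finite eventually_le_add_scaled) auto
  have 2: "\<forall>\<^sub>F e in at_right 0. \<forall>i j k. i \<noteq> j \<and> k \<in> ?S i j \<longrightarrow>
      0 + e * 0 \<le> Z $ k $ i $ j + e * Z' $ k $ i $ j"
    using v' w' by (intro eventually_all_finite eventually_le_add_scaled) auto
  have 3: "\<forall>\<^sub>F e in at_right 0. \<forall>i j. i \<noteq> j \<longrightarrow>
      1 + e * 0 \<le> (X $ i $ j + X $ j $ i + (\<Sum>k \<in> ?S i j. Z $ k $ i $ j))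
        + e * (X' $ i $ j + X' $ j $ i + (\<Sum>k \<in> ?S i j. Z' $ k $ i $ j))"
    using v' w' by (intro eventually_all_finite eventually_le_add_scaled) auto
  have 4: "\<forall>\<^sub>F e in at_right 0. \<forall>i j k. i \<noteq> j \<and> k \<in> ?S i j \<longrightarrow>
      Z $ k $ i $ j + e * Z' $ k $ i $ j \<le> X $ k $ i + e * X' $ k $ i"
    using v' w' by (intro eventually_all_finite eventually_le_add_scaled) auto
  have 5: "\<forall>\<^sub>F e in at_right 0. \<forall>i j k. i \<noteq> j \<and> k \<in> ?S i j \<longrightarrow>
      Z $ k $ i $ j + e * Z' $ k $ i $ j \<le> X $ k $ j + e * X' $ k $ j"
    using v' w' by (intro eventually_all_finite eventually_le_add_scaled) auto
  have 6: "\<forall>\<^sub>F e in at_right 0. \<forall>i. True \<longrightarrow>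
      (\<Sum>j \<in> UNIV - {i}. X $ j $ i) + e * (\<Sum>j \<in> UNIV - {i}. X' $ j $ i) \<le> D $ i + e * D' $ i"
    using v' w' by (intro eventually_all_finite eventually_le_add_scaled) auto
  from 1 2 3 4 5 6 show ?thesis
  proof eventually_elim
    case (elim e)
    then show ?case
      using v' w'
      by (simp add: stt_polyhedron_def sum.distrib distrib_left add_ac flip: sum_distrib_left)
  qed
qed

text \<open>Otherwise, for small \<open>e\<close>, the point would be the midpoint of two distinct
  feasible points \<open>v - e *\<^sub>R w\<close> and \<open>v + e *\<^sub>R w\<close>.\<close>

lemma extreme_point_tight_direction_eq_0:
  assumes v: "v extreme_point_of stt_polyhedron U" and w: "tight_direction U v w"
  shows "w = 0"
proof (rule ccontr)
  assume "w \<noteq> 0"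
  have vP: "v \<in> stt_polyhedron U" using v by (simp add: extreme_point_of_def)
  note eventually_add_tight_direction[OF vP w]
    eventually_add_tight_direction[OF vP tight_direction_minus[OF w]]
  moreover have "\<forall>\<^sub>F e in at_right 0. (e::real) > 0"
    by (simp add: eventually_at_right_less)
  ultimately have "\<forall>\<^sub>F e in at_right 0. v + e *\<^sub>R w \<in> stt_polyhedron U \<and>
      v - e *\<^sub>R w \<in> stt_polyhedron U \<and> e > 0"
    by eventually_elim simp
  then obtain e where e: "v + e *\<^sub>R w \<in> stt_polyhedron U" "v - e *\<^sub>R w \<in> stt_polyhedron U" "e > 0"
    using eventually_happens'[OF trivial_limit_at_right_real] by blast
  have "v - e *\<^sub>R w \<noteq> v + e *\<^sub>R w"
  proof
    assume "v - e *\<^sub>R w = v + e *\<^sub>R w"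
    then have "(2 * e) *\<^sub>R w = 0" by (simp add: algebra_simps flip: scaleR_2)
    then show False using e(3) \<open>w \<noteq> 0\<close> by simp
  qed
  then have "midpoint (v - e *\<^sub>R w) (v + e *\<^sub>R w) \<in> open_segment (v - e *\<^sub>R w) (v + e *\<^sub>R w)"
    by simp
  moreover have "midpoint (v - e *\<^sub>R w) (v + e *\<^sub>R w) = v"
    by (simp add: midpoint_def flip: scaleR_2)
  ultimately show False
    using v e by (auto simp: extreme_point_of_def)
qed

text \<open>Any other edge would close a triangle with the centre.\<close>

lemma star_edge_contains_centre:
  assumes "is_tree U" and c: "\<And>i. i \<noteq> c \<Longrightarrow> U c i" and "U i j"
  shows "i = c \<or> j = c"
proof (rule ccontr)
  assume "\<not> (i = c \<or> j = c)"
  moreover have "i \<noteq> j" "U j c"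
    using assms \<open>\<not> (i = c \<or> j = c)\<close> by (auto simp: is_tree_def irreflp_def symp_def)
  ultimately have "graph_cycle U [c, i, j]"
    using c assms(3) by (auto simp: graph_cycle_def)
  then show False using assms(1) by (auto simp: is_tree_def)
qed

text \<open>An interior node of a path has two distinct neighbours on it, whereas every neighbour of
  a leaf is the centre.\<close>

lemma strictly_between_star:
  assumes tree: "is_tree U" and c: "\<And>i. i \<noteq> c \<Longrightarrow> U c i" and "i \<noteq> j"
  shows "strictly_between U i j = (if i = c \<or> j = c then {} else {c})"
proof -
  have "k = c" if k: "k \<in> strictly_between U i j" for k
  proof (rule ccontr)
    assume "k \<noteq> c"
    obtain p where p: "path_between U i p j" and "k \<in> set p" and ij: "k \<noteq> i" "k \<noteq> j"
      using k by (auto simp: strictly_between_def)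
    from \<open>k \<in> set p\<close> obtain xs ys where xys: "p = xs @ k # ys" by (meson split_list)
    have "xs \<noteq> []" using p ij xys by (auto simp: path_between_def)
    then obtain xs' a where xs: "xs = xs' @ [a]" by (meson rev_exhaust)
    have "ys \<noteq> []" using p ij xys by (auto simp: path_between_def)
    then obtain b ys' where ys: "ys = b # ys'" by (meson list.exhaust)
    have "U a k" "U k b" "a \<noteq> b"
      using p by (auto simp: path_between_def xys xs ys successively_append_iff)
    then show False
      using star_edge_contains_centre[OF tree c] \<open>k \<noteq> c\<close> by metis
  qed
  moreover have "c \<in> strictly_between U i j" if "i \<noteq> c" "j \<noteq> c"
  proof -
    have "U i c" using tree c that by (auto simp: is_tree_def symp_def)
    then have "path_between U i [i, c, j] j"
      using c that assms(3) by (auto simp: path_between_def)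
    then show ?thesis
      using that by (force simp: strictly_between_def)
  qed
  \<comment> \<open>If an end is the centre, this excludes the only candidate
    \<open>c\<close>.\<close>
  moreover have "i \<notin> strictly_between U i j" "j \<notin> strictly_between U i j"
    by (auto simp: strictly_between_def)
  ultimately show ?thesis by auto
qed

lemma extreme_point_D_eq:
  assumes v: "(D, X, Z) extreme_point_of stt_polyhedron U"
  shows "D $ i = (\<Sum>j \<in> UNIV - {i}. X $ j $ i)"
proof (rule ccontr)
  assume "D $ i \<noteq> (\<Sum>j \<in> UNIV - {i}. X $ j $ i)"
  then have "tight_direction U (D, X, Z) (axis i 1, 0, 0)"
    by (auto simp: tight_direction_def axis_def)
  from extreme_point_tight_direction_eq_0[OF v this] show False
    by (simp add: prod_eq_iff axis_eq_0_iff)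
qed

text \<open>The trade preserves every sum of two opposite entries of \<open>X\<close> and avoids row
  \<open>c\<close>, which holds the only entries that bound some \<open>Z\<close>.\<close>

lemma extreme_point_leaves_X_eq_0:
  assumes v: "(D, X, Z) extreme_point_of stt_polyhedron U"
    and between: "\<And>i j. i \<noteq> j \<Longrightarrow> strictly_between U i j \<subseteq> {c}"
    and "i \<noteq> j" "i \<noteq> c" "j \<noteq> c"
  shows "X $ i $ j = 0 \<or> X $ j $ i = 0"
proof (rule ccontr)
  assume nz: "\<not> (X $ i $ j = 0 \<or> X $ j $ i = 0)"
  define X' :: "real ^ 'a ^ 'a" where
    "X' = (\<chi> a b. if a = i \<and> b = j then 1 else if a = j \<and> b = i then - 1 else 0)"
  have c: "X' $ c $ k = 0" for k using assms by (simp add: X'_def)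
  have anti: "X' $ a $ b + X' $ b $ a = 0" for a b using \<open>i \<noteq> j\<close> by (auto simp: X'_def)
  have zero: "X $ a $ b = 0 \<Longrightarrow> X' $ a $ b = 0" "X' $ a $ a = 0" for a b
    using nz \<open>i \<noteq> j\<close> by (auto simp: X'_def)
  \<comment> \<open>The first component follows the column sums, as a tight bound on
    \<open>D\<close> demands.\<close>
  have "tight_direction U (D, X, Z) (\<chi> b. \<Sum>a \<in> UNIV - {b}. X' $ a $ b, X', 0)"
    using between c anti zero by (fastforce simp: tight_direction_def)
  from extreme_point_tight_direction_eq_0[OF v this] have "X' $ i $ j = 0"
    by (simp add: prod_eq_iff)
  then show False by (simp add: X'_def)
qed

lemma sum_eq_1_Ints_iff:
  fixes a b :: "'a::ring_1"
  assumes "a + b = 1"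
  shows "a \<in> \<int> \<longleftrightarrow> b \<in> \<int>"
  using assms by (metis Ints_1 Ints_diff add_diff_cancel_left' add_diff_cancel_right')

lemma star_extreme_point_X_Z_Ints:
  assumes v: "(D, X, Z) extreme_point_of stt_polyhedron U"
    and between: "\<And>i j. i \<noteq> j \<Longrightarrow> strictly_between U i j = (if i = c \<or> j = c then {} else {c})"
  shows "X $ i $ j \<in> \<int>" and "Z $ k $ i $ j \<in> \<int>"
proof -
  have P: "(D, X, Z) \<in> stt_polyhedron U" using v by (simp add: extreme_point_of_def)
  have P0: "X $ a $ a = 0" "k \<notin> strictly_between U a b \<Longrightarrow> Z $ k $ a $ b = 0"
    "Z $ k $ a $ b = Z $ k $ b $ a" for a b k
    using P by (simp_all add: stt_polyhedron_def)
  have leaves: "X $ a $ b = 0 \<or> X $ b $ a = 0" if "a \<noteq> b" "a \<noteq> c" "b \<noteq> c" for a b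
    using extreme_point_leaves_X_eq_0[OF v _ that] between by auto
  \<comment> \<open>The direction vanishes exactly at the integer entries of \<open>X\<close> and
    \<open>Z\<close>, so its being zero makes all of them integer.\<close>
  define X' :: "real ^ 'a ^ 'a" where
    "X' = (\<chi> a b. if X $ a $ b \<in> \<int> then 0 else if a = c then 1 else - 1)"
  define Z' :: "real ^ 'a ^ 'a ^ 'a" where
    "Z' = (\<chi> k a b. if Z $ k $ a $ b \<in> \<int> then 0 else 1)"
  have cover: "X' $ a $ b + X' $ b $ a + (\<Sum>k \<in> strictly_between U a b. Z' $ k $ a $ b) = 0"
    if ab: "a \<noteq> b"
      and tight: "X $ a $ b + X $ b $ a + (\<Sum>k \<in> strictly_between U a b. Z $ k $ a $ b) = 1"
    for a b
  proof (cases "a = c \<or> b = c")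
    case True
    then have "X $ a $ b + X $ b $ a = 1" using tight between[OF ab] by simp
    \<comment> \<open>Exactly one of the two entries lies in row \<open>c\<close>, so their rates
      cancel when both are fractional.\<close>
    from sum_eq_1_Ints_iff[OF this] show ?thesis
      using True ab between[OF ab] by (auto simp: X'_def)
  next
    case False
    then have *: "X $ a $ b + X $ b $ a + Z $ c $ a $ b = 1" using tight between[OF ab] by simp
    \<comment> \<open>This leaves two terms with sum one, both fractional or both integer. Three
      fractional terms would have rates -1, -1 and 1, which do not cancel.\<close>
    have "X $ a $ b = 0 \<or> X $ b $ a = 0" using leaves ab False by blast
    then have "X' $ a $ b + X' $ b $ a + Z' $ c $ a $ b = 0"
    proof
      assume 0: "X $ a $ b = 0"
      then have "X $ b $ a \<in> \<int> \<longleftrightarrow> Z $ c $ a $ b \<in> \<int>" using * by (intro sum_eq_1_Ints_iff) simp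
      then show ?thesis using 0 False by (simp add: X'_def Z'_def)
    next
      assume 0: "X $ b $ a = 0"
      then have "X $ a $ b \<in> \<int> \<longleftrightarrow> Z $ c $ a $ b \<in> \<int>" using * by (intro sum_eq_1_Ints_iff) simp
      then show ?thesis using 0 False by (simp add: X'_def Z'_def)
    qed
    then show ?thesis using False between[OF ab] by simp
  qed
  \<comment> \<open>Equal entries get equal rates, since row \<open>c\<close> of \<open>X\<close>
    rises together with \<open>Z\<close>. The free index \<open>d\<close> serves both upper bounds
    on \<open>Z\<close>.\<close>
  have bound: "Z $ k $ a $ b = X $ k $ d \<Longrightarrow> Z' $ k $ a $ b = X' $ k $ d"
    if "a \<noteq> b" "k \<in> strictly_between U a b" for a b d k
  proof -
    have "k = c" using between[OF that(1)] that(2) by (simp split: if_splits)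
    then show "Z $ k $ a $ b = X $ k $ d \<Longrightarrow> Z' $ k $ a $ b = X' $ k $ d"
      by (simp add: X'_def Z'_def)
  qed
  have zero: "X $ a $ b = 0 \<Longrightarrow> X' $ a $ b = 0" "Z $ k $ a $ b = 0 \<Longrightarrow> Z' $ k $ a $ b = 0" for a b k
    by (simp_all add: X'_def Z'_def)
  have sym: "Z' $ k $ a $ b = Z' $ k $ b $ a" for a b k
    by (simp add: Z'_def P0(3)[of k a b])
  have "tight_direction U (D, X, Z) (\<chi> b. \<Sum>a \<in> UNIV - {b}. X' $ a $ b, X', Z')"
    unfolding tight_direction_def prod.case
    by (intro conjI allI impI ballI cover bound sym) (simp_all add: zero P0(1,2))
  from extreme_point_tight_direction_eq_0[OF v this]
  have "X' $ i $ j = 0" "Z' $ k $ i $ j = 0" by (simp_all add: prod_eq_iff)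
  then show "X $ i $ j \<in> \<int>" and "Z $ k $ i $ j \<in> \<int>"
    by (auto simp: X'_def Z'_def split: if_splits)
qed

theorem theorem3p9:
  fixes U :: "'n::finite \<Rightarrow> 'n \<Rightarrow> bool"
  assumes "star_topology U"
  shows "\<forall>v. v extreme_point_of stt_polyhedron U \<longrightarrow> integer_point v"
proof (intro allI impI)
  fix v assume v: "v extreme_point_of stt_polyhedron U"
  obtain D X Z where v_eq: "v = (D, X, Z)" by (cases v)
  obtain c where "is_tree U" "\<And>i. i \<noteq> c \<Longrightarrow> U c i"
    using assms by (auto simp: star_topology_def)
  note ints = star_extreme_point_X_Z_Ints[OF v[unfolded v_eq] strictly_between_star[OF this]]
  have "D $ i \<in> \<int>" for i
    unfolding extreme_point_D_eq[OF v[unfolded v_eq]] by (intro Ints_sum ints)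
  then show "integer_point v"
    using ints by (simp add: v_eq integer_point_def)
qed

end
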